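(* Every infinite $\sigma$-compact locally compact group has a quotient group which is an infinite separable metrizable group.
   Context: All topological groups are assumed to be Hausdorff. A quotient group of a topological group $G$ means $G/N$ with the quotient topology, where $N$ is a closed normal subgroup of $G$ (the case $N=\{e\}$ is allowed). A topological group is $\sigma$-compact if it is a union of countably many compact subsets. *)

theory Defs
  imports "HOL-Analysis.Analysis" "HOL-Algebra.Coset"
begin

text \<open>Topological groups are Hausdorff by convention.\<close>

locale topological_group = group G for G (structure) +
  fixes T :: "'a topology"
  assumes topspace_eq_carrier: "topspace T = carrier G"
    and Hausdorff: "Hausdorff_space T"
    and continuous_mult: "continuous_map (prod_topology T T) T (\<lambda>(x, y). x \<otimes> y)"
    and continuous_inv: "continuous_map T T (\<lambda>x. inv x)"

definition sigma_compact_space :: "'a topology \<Rightarrow> bool" where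
  "sigma_compact_space X \<longleftrightarrow>
     (\<exists>\<K>. countable \<K> \<and> (\<forall>K\<in>\<K>. compactin X K) \<and> \<Union>\<K> = topspace X)"

definition quotient_topology :: "'a topology \<Rightarrow> ('a \<Rightarrow> 'b) \<Rightarrow> 'b topology" where
  "quotient_topology X q =
     topology (\<lambda>U. U \<subseteq> q ` topspace X \<and> openin X {x \<in> topspace X. q x \<in> U})"

lemma openin_quotient_topology:
  "openin (quotient_topology X q) U \<longleftrightarrow>
     U \<subseteq> q ` topspace X \<and> openin X {x \<in> topspace X. q x \<in> U}"
proof -
  have "istopology (\<lambda>U. U \<subseteq> q ` topspace X \<and> openin X {x \<in> topspace X. q x \<in> U})"
    unfolding istopology_def
  proof (intro conjI allI impI)
    fix S T
    assume S: "S \<subseteq> q ` topspace X \<and> openin X {x \<in> topspace X. q x \<in> S}"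
      and T: "T \<subseteq> q ` topspace X \<and> openin X {x \<in> topspace X. q x \<in> T}"
    have "{x \<in> topspace X. q x \<in> S \<inter> T} =
        {x \<in> topspace X. q x \<in> S} \<inter> {x \<in> topspace X. q x \<in> T}"
      by auto
    moreover have "openin X ({x \<in> topspace X. q x \<in> S} \<inter> {x \<in> topspace X. q x \<in> T})"
      using S T by (intro openin_Int) auto
    ultimately show "openin X {x \<in> topspace X. q x \<in> S \<inter> T}"
      by (simp only:)
    show "S \<inter> T \<subseteq> q ` topspace X"
      using S by auto
  next
    fix \<U>
    assume U: "\<forall>U\<in>\<U>. U \<subseteq> q ` topspace X \<and> openin X {x \<in> topspace X. q x \<in> U}"
    have "{x \<in> topspace X. q x \<in> \<Union>\<U>} = (\<Union>U\<in>\<U>. {x \<in> topspace X. q x \<in> U})"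
      by auto
    moreover have "openin X (\<Union>U\<in>\<U>. {x \<in> topspace X. q x \<in> U})"
      using U by (intro openin_Union) auto
    ultimately show "openin X {x \<in> topspace X. q x \<in> \<Union>\<U>}"
      by (simp only:)
    show "\<Union>\<U> \<subseteq> q ` topspace X"
      using U by auto
  qed
  then show ?thesis
    unfolding quotient_topology_def by (rule topology_inverse'[THEN fun_cong])
qed

lemma topspace_quotient_topology: "topspace (quotient_topology X q) = q ` topspace X"
proof -
  have "{x \<in> topspace X. q x \<in> q ` topspace X} = topspace X"
    by auto
  then have "openin (quotient_topology X q) (q ` topspace X)"
    unfolding openin_quotient_topology by simp
  moreover have "topspace (quotient_topology X q) \<subseteq> q ` topspace X"
    using openin_topspace[of "quotient_topology X q"] unfolding openin_quotient_topology by (rule conjunct1)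
  ultimately show ?thesis
    by (simp add: openin_subset subset_antisym)
qed

lemma quotient_map_quotient_topology: "quotient_map X (quotient_topology X q) q"
  unfolding quotient_map_def openin_quotient_topology topspace_quotient_topology by blast

definition quotient_group_topology ::
    "('a, 'm) monoid_scheme \<Rightarrow> 'a topology \<Rightarrow> 'a set \<Rightarrow> 'a set topology" where
  "quotient_group_topology G T N = quotient_topology T (\<lambda>x. N #>\<^bsub>G\<^esub> x)"

end

theory Submission
  imports Defs
begin

text \<open>
  This is the Kakutani--Kodaira theorem together with a choice that keeps the quotient infinite.
  Exhaust \<open>G\<close> by compact sets \<open>K n\<close> and choose symmetric identity neighbourhoods \<open>V n\<close>,
  all inside one compact set, such that \<open>V (n + 1)\<close> lies in a prescribed \<open>U n\<close> and both
  \<open>V (n + 1) V (n + 1)\<close> and \<open>x V (n + 1) x\<^sup>-\<^sup>1\<close> for \<open>x \<in> K n\<close> lie in \<open>V n\<close>. Then \<open>N = \<Inter>n. V n\<close>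
  is a closed normal subgroup, and by compactness the images of the \<open>V n\<close> form a local base at
  the identity of \<open>G/N\<close>. Since \<open>G/N\<close> is Lindelof, it is second countable, and Urysohn's
  metrization theorem applies. Letting the \<open>U n\<close> avoid all quotients \<open>f i (f j)\<^sup>-\<^sup>1\<close>, \<open>i \<noteq> j\<close>, of an
  injective sequence \<open>f\<close> makes the cosets \<open>N (f i)\<close> distinct.
\<close>

section \<open>Urysohn's metrization theorem\<close>

text \<open>Each pair \<open>(U, V)\<close> of basic sets with the closure of \<open>U\<close>
  inside \<open>V\<close> has a Urysohn function that is 0 on that closure and 1 off
  \<open>V\<close>. There are countably many pairs, so these functions together embed
  \<open>X\<close> into a countable power of the real line, which is metrizable.\<close>

lemma second_countable_regular_Hausdorff_imp_metrizable_space: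
  assumes "regular_space X" "Hausdorff_space X" "second_countable X"
  shows "metrizable_space X"
proof -
  obtain \<B> where \<B>: "countable \<B>" "\<And>V. V \<in> \<B> \<Longrightarrow> openin X V"
    "\<And>U x. openin X U \<Longrightarrow> x \<in> U \<Longrightarrow> \<exists>V\<in>\<B>. x \<in> V \<and> V \<subseteq> U"
    using assms(3) unfolding second_countable_def by metis
  have "normal_space X"
    using assms regular_second_countable_imp_hereditarily_normal_space hereditarily_inc
    by metis
  define P where "P = {(U, V). U \<in> \<B> \<and> V \<in> \<B> \<and> X closure_of U \<subseteq> V}"
  have "countable P"
    by (rule countable_subset[of _ "\<B> \<times> \<B>"]) (use \<B>(1) in \<open>auto simp: P_def\<close>)
  have "\<exists>f::'a \<Rightarrow> real. continuous_map X euclideanreal f \<and>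
      f ` (X closure_of fst p) \<subseteq> {0} \<and> f ` (topspace X - snd p) \<subseteq> {1}" if "p \<in> P" for p
  proof -
    have "closedin X (topspace X - snd p)" "disjnt (X closure_of fst p) (topspace X - snd p)"
      using that \<B>(2) by (auto simp: P_def disjnt_def)
    then show ?thesis
      using \<open>normal_space X\<close> closedin_closure_of unfolding normal_space_iff_Urysohn
      by (metis continuous_map_in_subtopology)
  qed
  then obtain f :: "'a set \<times> 'a set \<Rightarrow> 'a \<Rightarrow> real"
    where f: "\<And>p. p \<in> P \<Longrightarrow> continuous_map X euclideanreal (f p)"
      "\<And>p. p \<in> P \<Longrightarrow> f p ` (X closure_of fst p) \<subseteq> {0}"
      "\<And>p. p \<in> P \<Longrightarrow> f p ` (topspace X - snd p) \<subseteq> {1}"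
    by metis
  define F where "F x = (\<lambda>p\<in>P. f p x)" for x
  let ?Y = "product_topology (\<lambda>_. euclideanreal) P"
  have cont: "continuous_map X ?Y F"
    using f(1) by (auto simp: continuous_map_componentwise F_def)
  \<comment> \<open>Regularity puts a closed neighbourhood of \<open>x\<close> inside a basic
    \<open>V\<close>, and a basic \<open>U\<close> inside that neighbourhood, so
    \<open>(U, V)\<close> is in \<open>P\<close>. Injectivity and openness of \<open>F\<close> both
    come from this separation.\<close>
  have sep: "\<exists>p\<in>P. f p x = 0 \<and> {y \<in> topspace X. f p y < 1} \<subseteq> W" if W: "openin X W" "x \<in> W" for W x
  proof -
    obtain V where V: "V \<in> \<B>" "x \<in> V" "V \<subseteq> W"
      using \<B>(3) W by metis
    obtain U' C where U': "openin X U'" "closedin X C" "x \<in> U'" "U' \<subseteq> C" "C \<subseteq> V"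
      using assms(1) V(2) \<B>(2)[OF V(1)]
      unfolding neighbourhood_base_of_closedin [symmetric] neighbourhood_base_of by metis
    obtain U where U: "U \<in> \<B>" "x \<in> U" "U \<subseteq> U'"
      using \<B>(3) U' by metis
    have "X closure_of U \<subseteq> V"
      using U U' by (meson closure_of_minimal order_trans)
    then have p: "(U, V) \<in> P"
      using U V by (simp add: P_def)
    have "x \<in> X closure_of U"
      using U \<B>(2) by (meson closure_of_subset openin_subset subsetD)
    then have "f (U, V) x = 0"
      using f(2)[OF p] by auto
    moreover have "f (U, V) y = 1" if "y \<in> topspace X - V" for y
      using f(3)[OF p] that by auto
    ultimately show ?thesis
      using p V(3) by force
  qed
  have inj: "inj_on F (topspace X)"
  proof (rule inj_onI, rule ccontr)
    fix x y
    assume xy: "x \<in> topspace X" "y \<in> topspace X" "F x = F y" "x \<noteq> y"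
    then obtain W where "openin X W" "x \<in> W" "y \<notin> W"
      using assms(2) unfolding Hausdorff_space_def disjnt_iff by metis
    then obtain p where p: "p \<in> P" "f p x = 0" "{y \<in> topspace X. f p y < 1} \<subseteq> W"
      using sep by metis
    have "f p x = f p y"
      using fun_cong[OF xy(3), of p] p(1) by (simp add: F_def)
    then show False
      using p xy(2) \<open>y \<notin> W\<close> by auto
  qed
  have "open_map X (subtopology ?Y (F ` topspace X)) F"
    unfolding open_map_def
  proof (intro allI impI)
    fix W
    assume W: "openin X W"
    \<comment> \<open>An open subset of the full product whose trace on the image of
      \<open>F\<close> is \<open>F\<close> followed by \<open>W\<close>: every point of
      \<open>W\<close> has an index from \<open>sep\<close>, and the condition on \<open>p\<close>
      keeps all other points of \<open>X\<close> out.\<close>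
    define S where "S = (\<Union>p\<in>{p\<in>P. {y \<in> topspace X. f p y < 1} \<subseteq> W}. {g \<in> topspace ?Y. g p \<in> {..<1}})"
    have "openin ?Y S"
    proof -
      have "openin ?Y {g \<in> topspace ?Y. g p \<in> {..<1}}" if "p \<in> P" for p
        by (rule openin_continuous_map_preimage[OF continuous_map_product_projection[OF that]]) auto
      then show ?thesis
        unfolding S_def by blast
    qed
    moreover have "F ` W = F ` topspace X \<inter> S"
    proof (intro subset_antisym subsetI)
      fix g assume "g \<in> F ` W"
      then obtain x where x: "x \<in> W" "g = F x" by auto
      then obtain p where p: "p \<in> P" "f p x = 0" "{y \<in> topspace X. f p y < 1} \<subseteq> W"
        using sep W by metis
      have "x \<in> topspace X"
        using x W openin_subset by auto
      moreover have "F x \<in> topspace ?Y" "F x p < 1"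
        using p by (auto simp: F_def)
      ultimately show "g \<in> F ` topspace X \<inter> S"
        using p x(2) unfolding S_def by blast
    next
      fix g assume "g \<in> F ` topspace X \<inter> S"
      then show "g \<in> F ` W"
        by (auto simp: S_def F_def)
    qed
    ultimately show "openin (subtopology ?Y (F ` topspace X)) (F ` W)"
      by (auto simp: openin_subtopology)
  qed
  then have "embedding_map X ?Y F"
    using cont inj embedding_map_in_subtopology[of X ?Y "F ` topspace X" F]
    by (metis continuous_map_in_subtopology image_subset_iff_funcset injective_open_imp_embedding_map order_refl)
  then have "X homeomorphic_space subtopology ?Y (F ` topspace X)"
    by (rule embedding_map_imp_homeomorphic_space)
  moreover have "metrizable_space ?Y"
    using \<open>countable P\<close> by (auto simp: metrizable_space_product_topology metrizable_space_euclidean)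
  ultimately show ?thesis
    using homeomorphic_metrizable_space metrizable_space_subtopology by metis
qed

section \<open>Products of open quotient maps\<close>

lemma open_map_map_prod:
  assumes "open_map X X' f" "open_map Y Y' g"
  shows "open_map (prod_topology X Y) (prod_topology X' Y') (map_prod f g)"
  unfolding open_map_def
proof (intro allI impI)
  fix W
  assume W: "openin (prod_topology X Y) W"
  show "openin (prod_topology X' Y') (map_prod f g ` W)"
    unfolding openin_prod_topology_alt
  proof (intro allI impI)
    fix x' y'
    assume "(x', y') \<in> map_prod f g ` W"
    then obtain x y where xy: "(x, y) \<in> W" "x' = f x" "y' = g y"
      by auto
    then obtain A B where AB: "openin X A" "openin Y B" "x \<in> A" "y \<in> B" "A \<times> B \<subseteq> W"
      using W unfolding openin_prod_topology_alt by meson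
    then have "f ` A \<times> g ` B \<subseteq> map_prod f g ` W"
      by (metis image_mono map_prod_surj_on)
    then show "\<exists>U V. openin X' U \<and> openin Y' V \<and> x' \<in> U \<and> y' \<in> V \<and> U \<times> V \<subseteq> map_prod f g ` W"
      using AB xy assms unfolding open_map_def by (intro exI[of _ "f ` A"] exI[of _ "g ` B"]) simp
  qed
qed

text \<open>A product of quotient maps need not be a quotient map; openness of the factors repairs
  this. It is what lets multiplication descend to a quotient group.\<close>

lemma quotient_map_map_prod_open:
  assumes "quotient_map X X' f" "open_map X X' f" "quotient_map Y Y' g" "open_map Y Y' g"
  shows "quotient_map (prod_topology X Y) (prod_topology X' Y') (map_prod f g)"
proof (rule continuous_open_imp_quotient_map)
  show "continuous_map (prod_topology X Y) (prod_topology X' Y') (map_prod f g)"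
    using assms(1,3) continuous_map_compose[OF continuous_map_fst, of X X' f Y]
      continuous_map_compose[OF continuous_map_snd, of Y Y' g X]
    by (simp add: map_prod_def split_def o_def continuous_map_pairedI quotient_imp_continuous_map)
  show "open_map (prod_topology X Y) (prod_topology X' Y') (map_prod f g)"
    using assms(2,4) by (rule open_map_map_prod)
  show "map_prod f g ` topspace (prod_topology X Y) = topspace (prod_topology X' Y')"
    using assms(1,3) by (simp add: quotient_map_def map_prod_surj_on)
qed

section \<open>Sigma-compactness and nested compact sets\<close>

lemma sigma_compact_imp_Lindelof_space:
  assumes "sigma_compact_space X"
  shows "Lindelof_space X"
proof -
  obtain \<K> where \<K>: "countable \<K>" "\<And>K. K \<in> \<K> \<Longrightarrow> compactin X K" "\<Union>\<K> = topspace X"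
    using assms unfolding sigma_compact_space_def by metis
  have "Lindelof_space (subtopology X (\<Union>\<K>))"
    using \<K> by (intro Lindelof_space_Union compact_imp_Lindelof_space) (auto simp: compact_space_subtopology)
  then show ?thesis
    by (simp add: \<K>(3))
qed

lemma sigma_compact_space_incseq:
  assumes "sigma_compact_space X"
  obtains K :: "nat \<Rightarrow> 'a set" where "\<And>n. compactin X (K n)" "incseq K" "(\<Union>n. K n) = topspace X"
proof -
  obtain \<K> where \<K>: "countable \<K>" "\<And>K. K \<in> \<K> \<Longrightarrow> compactin X K" "\<Union>\<K> = topspace X"
    using assms unfolding sigma_compact_space_def by metis
  \<comment> \<open>Inserting the empty set makes the family nonempty, so that the enumeration has
    exactly this family as its range.\<close>
  let ?f = "from_nat_into (insert {} \<K>)"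
  have f: "range ?f = insert {} \<K>"
    using \<K>(1) by (intro range_from_nat_into) auto
  show ?thesis
  proof
    show "compactin X (\<Union>i\<le>n. ?f i)" for n
      using f \<K>(2) by (intro compactin_Union) (auto, metis compactin_empty insertE rangeI)
    show "incseq (\<lambda>n. \<Union>i\<le>n. ?f i)"
      by (force simp: incseq_def)
    have "(\<Union>n. \<Union>i\<le>n. ?f i) = \<Union>(range ?f)"
      by auto
    then show "(\<Union>n. \<Union>i\<le>n. ?f i) = topspace X"
      using f \<K>(3) by simp
  qed
qed

text \<open>Otherwise the sets \<open>C n - W\<close> would be nonempty, closed and decreasing in
  the compact set \<open>C 0\<close>, and a common point of them would lie in the intersection of
  the \<open>C n\<close> but not in \<open>W\<close>.\<close>

lemma compactin_decseq_closed_subset_open: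
  fixes C :: "nat \<Rightarrow> 'a set"
  assumes "compactin X (C 0)" "\<And>n. closedin X (C n)" "decseq C"
    and "openin X W" "(\<Inter>n. C n) \<subseteq> W"
  shows "\<exists>n. C n \<subseteq> W"
proof (rule ccontr)
  assume neg: "\<nexists>n. C n \<subseteq> W"
  have sub: "C n \<subseteq> C 0" for n
    using assms(3) by (simp add: decseqD)
  have "(\<Inter>n. C n - W) \<noteq> {}"
  proof (rule compact_space_imp_nest)
    show "compact_space (subtopology X (C 0))"
      using assms(1) by (simp add: compact_space_subtopology)
    show "closedin (subtopology X (C 0)) (C n - W)" for n
      using assms(2,4) sub[of n] by (metis Diff_subset closedin_diff closedin_subset_topspace order_trans)
    show "C n - W \<noteq> {}" for n
      using neg by auto
    show "decseq (\<lambda>n. C n - W)"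
      using assms(3) by (auto simp: decseq_def)
  qed
  then show False
    using assms(5) by auto
qed

section \<open>Neighbourhoods of the identity in a topological group\<close>

context topological_group
begin

lemma continuous_map_mult:
  assumes "continuous_map X T f" "continuous_map X T g"
  shows "continuous_map X T (\<lambda>x. f x \<otimes> g x)"
proof -
  have "continuous_map X (prod_topology T T) (\<lambda>x. (f x, g x))"
    using assms by (simp add: continuous_map_pairedI)
  then show ?thesis
    using continuous_map_compose[OF _ continuous_mult] by (fastforce simp: o_def)
qed

lemma continuous_map_inv:
  assumes "continuous_map X T f"
  shows "continuous_map X T (\<lambda>x. inv (f x))"
  using continuous_map_compose[OF assms continuous_inv] by (simp add: o_def)

lemma openin_left_translate:
  assumes "openin T U" "a \<in> carrier G"
  shows "openin T {x \<in> carrier G. a \<otimes> x \<in> U}"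
  using openin_continuous_map_preimage[OF continuous_map_mult[OF _ continuous_map_id[unfolded id_def]] assms(1),
      of "\<lambda>_. a"] assms(2)
  by (simp add: topspace_eq_carrier)

lemma openin_inv_preimage:
  assumes "openin T U"
  shows "openin T {x \<in> carrier G. inv x \<in> U}"
  using openin_continuous_map_preimage[OF continuous_inv assms] by (simp add: topspace_eq_carrier)

lemma openin_subset_carrier: "openin T U \<Longrightarrow> U \<subseteq> carrier G"
  using openin_subset topspace_eq_carrier by metis

lemma mult_neighbourhood_one:
  assumes "openin T U" "\<one> \<in> U"
  obtains V where "openin T V" "\<one> \<in> V" "\<And>x y. x \<in> V \<Longrightarrow> y \<in> V \<Longrightarrow> x \<otimes> y \<in> U"
proof -
  let ?W = "{z \<in> topspace (prod_topology T T). (\<lambda>(x, y). x \<otimes> y) z \<in> U}"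
  have "openin (prod_topology T T) ?W"
    by (rule openin_continuous_map_preimage[OF continuous_mult assms(1)])
  moreover have "(\<one>, \<one>) \<in> ?W"
    using assms(2) by (simp add: topspace_eq_carrier)
  ultimately obtain A B where AB: "openin T A" "openin T B" "\<one> \<in> A" "\<one> \<in> B" "A \<times> B \<subseteq> ?W"
    unfolding openin_prod_topology_alt by meson
  show ?thesis
    by (rule that[of "A \<inter> B"]) (use AB in \<open>auto intro: openin_Int\<close>)
qed

text \<open>This is the tube lemma: the preimage of \<open>U\<close> under \<open>(x, v)\<close> to
  \<open>x v x^-1\<close> is open and contains \<open>K \<times> {\<one>}\<close>, so one
  \<open>V\<close> serves all \<open>x\<close> in the compact set \<open>K\<close>.\<close>

lemma conj_neighbourhood_one:
  assumes "openin T U" "\<one> \<in> U" "compactin T K"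
  obtains V where "openin T V" "\<one> \<in> V" "\<And>x v. x \<in> K \<Longrightarrow> v \<in> V \<Longrightarrow> x \<otimes> v \<otimes> inv x \<in> U"
proof -
  let ?W = "{z \<in> topspace (prod_topology T T). fst z \<otimes> snd z \<otimes> inv (fst z) \<in> U}"
  have "continuous_map (prod_topology T T) T (\<lambda>z. fst z \<otimes> snd z \<otimes> inv (fst z))"
    by (intro continuous_map_mult continuous_map_inv continuous_map_fst continuous_map_snd)
  then have W: "openin (prod_topology T T) ?W"
    by (rule openin_continuous_map_preimage[OF _ assms(1)])
  have K: "K \<times> {\<one>} \<subseteq> ?W"
    using compactin_subset_topspace[OF assms(3)] assms(2) by (auto simp: topspace_eq_carrier subset_iff)
  have "compactin T {\<one>}"
    by (simp add: topspace_eq_carrier)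
  then obtain A V where AV: "openin T A" "openin T V" "K \<subseteq> A" "{\<one>} \<subseteq> V" "A \<times> V \<subseteq> ?W"
    by (rule Wallace_theorem_prod_topology[OF assms(3) _ W K])
  show ?thesis
    by (rule that[of V]) (use AV in \<open>auto dest!: subsetD\<close>)
qed

text \<open>The product and conjugation conditions survive shrinking, so the two neighbourhoods are
  intersected, and then intersected with the preimage under inversion to gain symmetry.\<close>

lemma small_symmetric_neighbourhood_one:
  assumes "openin T U" "\<one> \<in> U" "compactin T K"
  obtains V where "openin T V" "\<one> \<in> V" "\<And>x. x \<in> V \<Longrightarrow> inv x \<in> V"
    "\<And>x y. x \<in> V \<Longrightarrow> y \<in> V \<Longrightarrow> x \<otimes> y \<in> U"
    "\<And>x v. x \<in> K \<Longrightarrow> v \<in> V \<Longrightarrow> x \<otimes> v \<otimes> inv x \<in> U"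
proof -
  obtain A where A: "openin T A" "\<one> \<in> A" "\<And>x y. x \<in> A \<Longrightarrow> y \<in> A \<Longrightarrow> x \<otimes> y \<in> U"
    using mult_neighbourhood_one[OF assms(1,2)] by metis
  obtain B where B: "openin T B" "\<one> \<in> B" "\<And>x v. x \<in> K \<Longrightarrow> v \<in> B \<Longrightarrow> x \<otimes> v \<otimes> inv x \<in> U"
    using conj_neighbourhood_one[OF assms] by metis
  have sub: "A \<inter> B \<subseteq> carrier G"
    using openin_subset_carrier[OF A(1)] by blast
  show ?thesis
  proof (rule that[of "A \<inter> B \<inter> {x \<in> carrier G. inv x \<in> A \<inter> B}"])
    show "openin T (A \<inter> B \<inter> {x \<in> carrier G. inv x \<in> A \<inter> B})"
      using A(1) B(1) by (intro openin_Int openin_inv_preimage) auto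
  qed (use A B sub in auto)
qed

text \<open>If \<open>x\<close> is in the closure of \<open>V\<close>, its neighbourhood
  \<open>x V\<close> meets \<open>V\<close> in some \<open>y\<close>. Then
  \<open>x = y (x^-1 y)^-1\<close> is a product of two elements of the symmetric set
  \<open>V\<close>.\<close>

lemma closure_of_subset_mult:
  assumes "openin T V" "\<one> \<in> V" "\<And>x. x \<in> V \<Longrightarrow> inv x \<in> V" "\<And>x y. x \<in> V \<Longrightarrow> y \<in> V \<Longrightarrow> x \<otimes> y \<in> U"
  shows "T closure_of V \<subseteq> U"
proof
  fix x assume x: "x \<in> T closure_of V"
  then have xc: "x \<in> carrier G"
    using topspace_eq_carrier by (metis in_closure_of)
  have "openin T {y \<in> carrier G. inv x \<otimes> y \<in> V}"
    using assms(1) xc by (intro openin_left_translate) auto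
  moreover have "x \<in> {y \<in> carrier G. inv x \<otimes> y \<in> V}"
    using xc assms(2) by simp
  ultimately obtain y where "y \<in> V" "y \<in> {y \<in> carrier G. inv x \<otimes> y \<in> V}"
    using x unfolding in_closure_of by meson
  then have y: "y \<in> V" "y \<in> carrier G" "inv x \<otimes> y \<in> V"
    by auto
  have "x = y \<otimes> inv (inv x \<otimes> y)"
    using xc y(2) by (simp add: inv_mult_group flip: m_assoc)
  then show "x \<in> U"
    using y assms(3,4) by metis
qed

section \<open>Small closed normal subgroups with a countable neighbourhood base\<close>

text \<open>The free choice of the \<open>U n\<close> lets \<open>N\<close> avoid countably many
  prescribed closed sets missing the identity. The last clause becomes a countable local base at the
  identity of the quotient.\<close>

lemma Kakutani_Kodaira:
  fixes U :: "nat \<Rightarrow> 'a set"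
  assumes "sigma_compact_space T" "locally_compact_space T"
    and U: "\<And>n. openin T (U n)" "\<And>n. \<one> \<in> U n"
  obtains N V where "N \<lhd> G" "closedin T N" "N \<subseteq> (\<Inter>n. U n)"
    "\<And>n::nat. openin T (V n)" "\<And>n. N \<subseteq> V n"
    "\<And>W. openin T W \<Longrightarrow> N \<subseteq> W \<Longrightarrow> \<exists>n. V n \<subseteq> W"
proof -
  obtain K :: "nat \<Rightarrow> 'a set" where K: "\<And>n. compactin T (K n)" "incseq K" "(\<Union>n. K n) = carrier G"
    using sigma_compact_space_incseq[OF assms(1)] topspace_eq_carrier by metis
  obtain O' C where OC: "openin T O'" "compactin T C" "\<one> \<in> O'" "O' \<subseteq> C"
    using assms(2) topspace_eq_carrier unfolding locally_compact_space_def by (metis one_closed)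
  \<comment> \<open>\<open>P\<close> holds of every chosen neighbourhood; \<open>Q\<close> links a
    neighbourhood to its successor.\<close>
  define P where "P V \<longleftrightarrow> openin T V \<and> \<one> \<in> V \<and> (\<forall>x\<in>V. inv x \<in> V) \<and> V \<subseteq> C" for V
  define Q where "Q n V V' \<longleftrightarrow> (\<forall>x\<in>V'. \<forall>y\<in>V'. x \<otimes> y \<in> V) \<and>
     (\<forall>x\<in>K n. \<forall>v\<in>V'. x \<otimes> v \<otimes> inv x \<in> V) \<and> V' \<subseteq> U n" for n V V'
  \<comment> \<open>Symmetry of \<open>V\<close> is not assumed, so the same step also yields the
    first neighbourhood from \<open>O'\<close>.\<close>
  have step: "\<exists>V'. P V' \<and> Q n V V'" if nbhd: "openin T V" "\<one> \<in> V" "V \<subseteq> C" for n V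
  proof -
    obtain V' where V': "openin T V'" "\<one> \<in> V'" "\<And>x. x \<in> V' \<Longrightarrow> inv x \<in> V'"
      "\<And>x y. x \<in> V' \<Longrightarrow> y \<in> V' \<Longrightarrow> x \<otimes> y \<in> V \<inter> U n"
      "\<And>x v. x \<in> K n \<Longrightarrow> v \<in> V' \<Longrightarrow> x \<otimes> v \<otimes> inv x \<in> V \<inter> U n"
    proof (rule small_symmetric_neighbourhood_one[of "V \<inter> U n" "K n"])
      show "openin T (V \<inter> U n)" "\<one> \<in> V \<inter> U n" "compactin T (K n)"
        using nbhd U K(1) by auto
    qed blast
    \<comment> \<open>Each \<open>x\<close> in \<open>V'\<close> is the product of \<open>x\<close>
      and \<open>\<one>\<close>, both in \<open>V'\<close>.\<close>
    have "V' \<subseteq> V \<inter> U n"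
      using V'(2,4) openin_subset_carrier[OF V'(1)] by (metis r_one subset_iff)
    then have "P V' \<and> Q n V V'"
      using V' nbhd(3) unfolding P_def Q_def by blast
    then show ?thesis ..
  qed
  have "\<exists>V. \<forall>n. P (V n) \<and> Q n (V n) (V (Suc n))"
  proof (rule dependent_nat_choice)
    show "\<exists>V. P V"
      using step[of O'] OC by blast
    show "\<exists>V'. P V' \<and> Q n V V'" if "P V" for V n
      using step[of V n] that by (simp add: P_def)
  qed
  then obtain V where V: "\<And>n. P (V n)" "\<And>n. Q n (V n) (V (Suc n))"
    by metis
  have Vc: "V n \<subseteq> carrier G" for n
    using V(1) openin_subset_carrier by (simp add: P_def)
  have cl: "T closure_of V (Suc n) \<subseteq> V n" for n
    using V(1)[of "Suc n"] V(2)[of n] by (intro closure_of_subset_mult) (auto simp: P_def Q_def)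
  have subcl: "V n \<subseteq> T closure_of V n" for n
    by (simp add: Vc closure_of_subset topspace_eq_carrier)
  have dec: "decseq V"
    using cl subcl by (intro decseq_SucI) blast
  define N where "N = (\<Inter>n. V n)"
  have NV: "N \<subseteq> V n" for n
    by (auto simp: N_def)
  \<comment> \<open>The closures interlace with the \<open>V n\<close> by \<open>cl\<close>. Writing
    \<open>N\<close> with closed sets gives its closedness and makes the compactness argument below
    applicable.\<close>
  have Ncl: "N = (\<Inter>n. T closure_of V n)"
  proof
    show "N \<subseteq> (\<Inter>n. T closure_of V n)"
      using NV subcl by blast
    show "(\<Inter>n. T closure_of V n) \<subseteq> N"
      using cl unfolding N_def by blast
  qed
  show ?thesis
  proof (rule that[of N V])
    have "subgroup N G"
    proof (rule subgroupI)
      show "N \<subseteq> carrier G"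
        using NV Vc by blast
      have "\<one> \<in> N"
        using V(1) by (simp add: N_def P_def)
      then show "N \<noteq> {}"
        by auto
      show "inv a \<in> N" if "a \<in> N" for a
        using V(1) that by (simp add: N_def P_def)
      show "a \<otimes> b \<in> N" if "a \<in> N" "b \<in> N" for a b
        using V(2) that by (simp add: N_def Q_def)
    qed
    moreover have "x \<otimes> h \<otimes> inv x \<in> N" if xh: "x \<in> carrier G" "h \<in> N" for x h
    proof -
      obtain m where m: "x \<in> K m"
        using xh(1) K(3) by blast
      have "x \<otimes> h \<otimes> inv x \<in> V n" for n
      proof -
        \<comment> \<open>The index must be at least \<open>m\<close> for \<open>K\<close> to
          contain \<open>x\<close>, and at least \<open>n\<close> for the conjugate to end up in
          \<open>V n\<close>.\<close>
        have "x \<in> K (max m n)"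
          using m K(2) by (meson incseqD max.cobounded1 subsetD)
        then have "x \<otimes> h \<otimes> inv x \<in> V (max m n)"
          using V(2)[of "max m n"] xh(2) by (simp add: N_def Q_def)
        then show ?thesis
          using decseqD[OF dec, of n "max m n"] by auto
      qed
      then show ?thesis
        by (simp add: N_def)
    qed
    ultimately show "N \<lhd> G"
      by (simp add: normal_inv_iff)
    show "closedin T N"
      unfolding Ncl by (intro closedin_Inter) auto
    show "N \<subseteq> (\<Inter>n. U n)"
    proof (rule INF_greatest)
      show "N \<subseteq> U n" for n
        using NV[of "Suc n"] V(2)[of n] unfolding Q_def by (elim conjE) (rule order_trans)
    qed
    show "openin T (V n)" for n
      using V(1) by (simp add: P_def)
    show "N \<subseteq> V n" for n
      by (rule NV)
    fix W
    assume W: "openin T W" "N \<subseteq> W"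
    \<comment> \<open>Compact sets are closed in a Hausdorff space, so the closure of
      \<open>V 0\<close> stays inside \<open>C\<close> and is compact.\<close>
    have closed_C: "closedin T C"
      using OC(2) Hausdorff by (simp add: compactin_imp_closedin)
    have "T closure_of V 0 \<subseteq> C"
      using V(1) closed_C by (simp add: P_def closure_of_minimal)
    then have "compactin T (T closure_of V 0)"
      using OC(2) by (meson closed_compactin closedin_closure_of)
    moreover have "decseq (\<lambda>n. T closure_of V n)"
      using dec by (simp add: decseq_def closure_of_mono)
    ultimately have "\<exists>n. T closure_of V n \<subseteq> W"
      using W Ncl by (intro compactin_decseq_closed_subset_open) auto
    then show "\<exists>n. V n \<subseteq> W"
      using subcl by blast
  qed
qed

section \<open>Second countability from a countable local base\<close>

text \<open>For each \<open>n\<close>, countably many left translates of \<open>V n\<close> cover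
  the group by the Lindelof property. These translates, over all \<open>n\<close>, form a
  base.\<close>

lemma second_countable_if_Lindelof:
  fixes V :: "nat \<Rightarrow> 'a set"
  assumes "Lindelof_space T" and V: "\<And>n. openin T (V n)" "\<And>n. \<one> \<in> V n"
    and base: "\<And>W. openin T W \<Longrightarrow> \<one> \<in> W \<Longrightarrow> \<exists>n. V n \<subseteq> W"
  shows "second_countable T"
proof -
  \<comment> \<open>\<open>tr n d\<close> is the translate \<open>d V n\<close>, written as a
    preimage so that its openness follows from continuity.\<close>
  define tr where "tr n d = {x \<in> carrier G. inv d \<otimes> x \<in> V n}" for n d
  have tr: "openin T (tr n d)" if "d \<in> carrier G" for n d
    unfolding tr_def using V(1) that by (intro openin_left_translate) auto
  have "\<exists>\<D>. countable \<D> \<and> \<D> \<subseteq> tr n ` carrier G \<and> \<Union>\<D> = carrier G" for n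
  proof -
    have "d \<in> tr n d" if "d \<in> carrier G" for d
      using that V(2) by (simp add: tr_def)
    moreover have "tr n d \<subseteq> carrier G" for d
      by (auto simp: tr_def)
    ultimately have "\<Union>(tr n ` carrier G) = carrier G"
      by blast
    then show ?thesis
      using Lindelof_spaceD[OF assms(1), of "tr n ` carrier G"] tr unfolding topspace_eq_carrier by blast
  qed
  then obtain \<D> where \<D>: "\<And>n. countable (\<D> n)" "\<And>n. \<D> n \<subseteq> tr n ` carrier G" "\<And>n. \<Union>(\<D> n) = carrier G"
    by metis
  have "\<exists>B\<in>(\<Union>n. \<D> n). x \<in> B \<and> B \<subseteq> W" if W: "openin T W" and x: "x \<in> W" for W x
  proof -
    have xc: "x \<in> carrier G"
      using W x openin_subset_carrier by blast
    have "openin T {y \<in> carrier G. x \<otimes> y \<in> W}" "\<one> \<in> {y \<in> carrier G. x \<otimes> y \<in> W}"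
      using W x xc by (auto intro: openin_left_translate)
    \<comment> \<open>Here \<open>A\<close> is symmetric with \<open>A A\<close> inside
      \<open>x^-1 W\<close>. If \<open>x\<close> and \<open>y\<close> both lie in
      \<open>d V n\<close> with \<open>V n\<close> inside \<open>A\<close>, then
      \<open>x^-1 y = (d^-1 x)^-1 (d^-1 y)\<close> is in \<open>A A\<close>, hence \<open>y\<close>
      is in \<open>W\<close>.\<close>
    then obtain A where A: "openin T A" "\<one> \<in> A" "\<And>y. y \<in> A \<Longrightarrow> inv y \<in> A"
      "\<And>y z. y \<in> A \<Longrightarrow> z \<in> A \<Longrightarrow> y \<otimes> z \<in> {y \<in> carrier G. x \<otimes> y \<in> W}"
      by (rule small_symmetric_neighbourhood_one[OF _ _ compactin_empty]) (blast intro: that)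
    obtain n where n: "V n \<subseteq> A"
      using base A by metis
    have "x \<in> \<Union>(\<D> n)"
      using \<D>(3) xc by simp
    then obtain d where d: "d \<in> carrier G" "tr n d \<in> \<D> n" "x \<in> tr n d"
      using \<D>(2)[of n] by auto
    have "y \<in> W" if "y \<in> tr n d" for y
    proof -
      have y: "y \<in> carrier G" "inv d \<otimes> y \<in> A" "inv d \<otimes> x \<in> A"
        using that d(3) n by (auto simp: tr_def)
      have "x \<otimes> (inv (inv d \<otimes> x) \<otimes> (inv d \<otimes> y)) \<in> W"
        using A(3,4) y by blast
      moreover have "x \<otimes> (inv (inv d \<otimes> x) \<otimes> (inv d \<otimes> y)) = y"
      proof -
        have cancel: "a \<otimes> (inv a \<otimes> b) = b" if "a \<in> carrier G" "b \<in> carrier G" for a b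
          using that by (simp flip: m_assoc)
        show ?thesis
          using xc y(1) d(1) by (simp add: inv_mult_group m_assoc cancel)
      qed
      ultimately show ?thesis
        by simp
    qed
    then show ?thesis
      using d by blast
  qed
  moreover have "countable (\<Union>n. \<D> n)"
    using \<D>(1) by simp
  moreover have "openin T B" if "B \<in> (\<Union>n. \<D> n)" for B
    using that \<D>(2) tr by blast
  ultimately show ?thesis
    unfolding second_countable_def by blast
qed

section \<open>The quotient by a closed normal subgroup as a topological group\<close>

text \<open>The preimage of the image of \<open>U\<close> is the union of the translates
  \<open>n^-1 U\<close> with \<open>n\<close> in \<open>N\<close>, which are open.\<close>

lemma open_map_rcoset:
  assumes "N \<lhd> G"
  shows "open_map T (quotient_group_topology G T N) (\<lambda>x. N #> x)"
  unfolding open_map_def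
proof (intro allI impI)
  fix U assume U: "openin T U"
  interpret N: normal N G by fact
  have "{x \<in> carrier G. N #> x \<in> (\<lambda>x. N #> x) ` U} = (\<Union>n\<in>N. {x \<in> carrier G. n \<otimes> x \<in> U})"
  proof (intro subset_antisym subsetI)
    fix x assume "x \<in> {x \<in> carrier G. N #> x \<in> (\<lambda>x. N #> x) ` U}"
    then obtain u where u: "x \<in> carrier G" "u \<in> U" "N #> x = N #> u"
      by auto
    then have "u \<in> N #> x"
      using rcos_self[OF _ N.subgroup_axioms] openin_subset_carrier[OF U] by (metis subsetD)
    then obtain n where "n \<in> N" "u = n \<otimes> x"
      unfolding r_coset_def by auto
    then show "x \<in> (\<Union>n\<in>N. {x \<in> carrier G. n \<otimes> x \<in> U})"
      using u by auto
  next
    fix x assume "x \<in> (\<Union>n\<in>N. {x \<in> carrier G. n \<otimes> x \<in> U})"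
    then obtain n where n: "n \<in> N" "x \<in> carrier G" "n \<otimes> x \<in> U"
      by auto
    then have "N #> x = N #> (n \<otimes> x)"
      by (intro repr_independence[OF _ _ N.subgroup_axioms]) (auto simp: r_coset_def)
    then show "x \<in> {x \<in> carrier G. N #> x \<in> (\<lambda>x. N #> x) ` U}"
      using n by auto
  qed
  moreover have "openin T (\<Union>n\<in>N. {x \<in> carrier G. n \<otimes> x \<in> U})"
    using U by (intro openin_Union) (auto intro: openin_left_translate)
  ultimately show "openin (quotient_group_topology G T N) ((\<lambda>x. N #> x) ` U)"
    using openin_subset_carrier[OF U]
    by (auto simp: quotient_group_topology_def openin_quotient_topology topspace_eq_carrier)
qed

lemma quotient_map_rcoset: "quotient_map T (quotient_group_topology G T N) (\<lambda>x. N #> x)"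
  unfolding quotient_group_topology_def by (rule quotient_map_quotient_topology)

lemma topspace_quotient_group_topology:
  "topspace (quotient_group_topology G T N) = carrier (G Mod N)"
  by (auto simp: quotient_group_topology_def topspace_quotient_topology topspace_eq_carrier
      FactGroup_def RCOSETS_def)

lemma rcoset_eq_iff:
  assumes "subgroup N G" "x \<in> carrier G" "y \<in> carrier G"
  shows "N #> x = N #> y \<longleftrightarrow> x \<otimes> inv y \<in> N"
proof -
  interpret subgroup N G by fact
  have "N #> x = N #> y \<longleftrightarrow> x \<in> N #> y"
    using assms by (metis rcos_self repr_independence)
  also have "\<dots> \<longleftrightarrow> x \<otimes> inv y \<in> N"
  proof
    assume "x \<in> N #> y"
    then obtain n where "n \<in> N" "x = n \<otimes> y"
      by (auto simp: r_coset_def)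
    then show "x \<otimes> inv y \<in> N"
      using assms by (simp add: m_assoc)
  next
    assume "x \<otimes> inv y \<in> N"
    moreover have "x = (x \<otimes> inv y) \<otimes> y"
      using assms by (simp add: m_assoc)
    ultimately show "x \<in> N #> y"
      by (auto simp: r_coset_def)
  qed
  finally show ?thesis .
qed

text \<open>For distinct cosets of \<open>a\<close> and \<open>b\<close>, the element
  \<open>a b^-1\<close> lies in the open complement of \<open>N\<close>. Continuity gives
  neighbourhoods \<open>U\<close> of \<open>a\<close> and \<open>V\<close> of \<open>b\<close> with
  \<open>u v^-1\<close> never in \<open>N\<close>; their images are open and disjoint.\<close>

lemma Hausdorff_space_quotient_group_topology:
  assumes "N \<lhd> G" "closedin T N"
  shows "Hausdorff_space (quotient_group_topology G T N)"
  unfolding Hausdorff_space_def topspace_quotient_group_topology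
proof (intro allI impI, elim conjE)
  interpret N: normal N G by fact
  fix A B
  assume A: "A \<in> carrier (G Mod N)" and B: "B \<in> carrier (G Mod N)" and "A \<noteq> B"
  then obtain a b where ab: "a \<in> carrier G" "b \<in> carrier G" "A = N #> a" "B = N #> b"
    by (auto simp: FactGroup_def RCOSETS_def)
  let ?W = "{z \<in> topspace (prod_topology T T). fst z \<otimes> inv (snd z) \<in> carrier G - N}"
  have "continuous_map (prod_topology T T) T (\<lambda>z. fst z \<otimes> inv (snd z))"
    by (intro continuous_map_mult continuous_map_inv continuous_map_fst continuous_map_snd)
  moreover have "openin T (carrier G - N)"
    using assms(2) by (simp add: closedin_def topspace_eq_carrier)
  ultimately have "openin (prod_topology T T) ?W"
    by (rule openin_continuous_map_preimage)
  moreover have "(a, b) \<in> ?W"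
    using ab \<open>A \<noteq> B\<close> by (simp add: rcoset_eq_iff N.subgroup_axioms topspace_eq_carrier)
  ultimately obtain U V where UV: "openin T U" "openin T V" "a \<in> U" "b \<in> V" "U \<times> V \<subseteq> ?W"
    unfolding openin_prod_topology_alt by meson
  have "disjnt ((\<lambda>x. N #> x) ` U) ((\<lambda>x. N #> x) ` V)"
    unfolding disjnt_iff
  proof (intro allI notI, elim conjE imageE)
    fix Z u v assume "Z = N #> u" "Z = N #> v" "u \<in> U" "v \<in> V"
    then have "u \<in> carrier G" "v \<in> carrier G" "u \<otimes> inv v \<notin> N" "N #> u = N #> v"
      using UV(5) by (auto simp: topspace_eq_carrier)
    then show False
      by (simp add: rcoset_eq_iff N.subgroup_axioms)
  qed
  then show "\<exists>U V. openin (quotient_group_topology G T N) U \<and> openin (quotient_group_topology G T N) V \<and>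
      A \<in> U \<and> B \<in> V \<and> disjnt U V"
    using UV open_map_rcoset[OF assms(1)] ab unfolding open_map_def by blast
qed

text \<open>Each operation is continuous once composed with the coset map, and continuity descends
  along quotient maps. For multiplication the map in question is the square of the coset map, a
  quotient map because the coset map is open.\<close>

lemma topological_group_quotient:
  assumes "N \<lhd> G" "closedin T N"
  shows "topological_group (G Mod N) (quotient_group_topology G T N)"
proof -
  interpret N: normal N G by fact
  interpret Q: group "G Mod N" by (rule N.factorgroup_is_group)
  let ?Q = "quotient_group_topology G T N" and ?q = "\<lambda>x. N #> x"
  have cont_q: "continuous_map T ?Q ?q"
    using quotient_map_rcoset by (rule quotient_imp_continuous_map)
  show ?thesis
  proof
    show "topspace ?Q = carrier (G Mod N)"
      by (rule topspace_quotient_group_topology)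
    show "Hausdorff_space ?Q"
      using assms by (rule Hausdorff_space_quotient_group_topology)
    have "continuous_map (prod_topology T T) ?Q (\<lambda>z. N #> (fst z \<otimes> snd z))"
      using continuous_map_compose[OF continuous_map_mult[OF continuous_map_fst continuous_map_snd] cont_q]
      by (simp add: o_def)
    then have "continuous_map (prod_topology T T) ?Q
        ((\<lambda>(x, y). x \<otimes>\<^bsub>G Mod N\<^esub> y) \<circ> map_prod ?q ?q)"
      by (rule continuous_map_eq) (auto simp: topspace_eq_carrier N.rcos_sum)
    then show "continuous_map (prod_topology ?Q ?Q) ?Q (\<lambda>(x, y). x \<otimes>\<^bsub>G Mod N\<^esub> y)"
      by (rule continuous_compose_quotient_map[rotated])
        (intro quotient_map_map_prod_open quotient_map_rcoset open_map_rcoset assms(1))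
    have "inv\<^bsub>G Mod N\<^esub> (N #> x) = N #> inv x" if "x \<in> carrier G" for x
    proof -
      have "N #> x \<in> carrier (G Mod N)"
        using that by (auto simp: FactGroup_def RCOSETS_def)
      then show ?thesis
        using that by (simp add: N.inv_FactGroup N.rcos_inv)
    qed
    moreover have "continuous_map T ?Q (\<lambda>x. N #> inv x)"
      using continuous_map_compose[OF continuous_inv cont_q] by (simp add: o_def)
    ultimately have "continuous_map T ?Q ((\<lambda>x. inv\<^bsub>G Mod N\<^esub> x) \<circ> ?q)"
      by (auto simp: topspace_eq_carrier elim: continuous_map_eq)
    then show "continuous_map ?Q ?Q (\<lambda>x. inv\<^bsub>G Mod N\<^esub> x)"
      by (rule continuous_compose_quotient_map[OF quotient_map_rcoset])
  qed
qed

end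

section \<open>An infinite separable metrizable quotient\<close>

theorem theorem2p16:
  fixes G :: "('a, 'm) monoid_scheme" and T :: "'a topology"
  assumes "topological_group G T"
    and "infinite (carrier G)"
    and "sigma_compact_space T"
    and "locally_compact_space T"
  shows "\<exists>N. N \<lhd> G \<and> closedin T N \<and>
    topological_group (G Mod N) (quotient_group_topology G T N) \<and>
    infinite (carrier (G Mod N)) \<and>
    separable_space (quotient_group_topology G T N) \<and>
    metrizable_space (quotient_group_topology G T N)"
proof -
  interpret topological_group G T by fact
  obtain f :: "nat \<Rightarrow> 'a" where f: "inj f" "range f \<subseteq> carrier G"
    using assms(2) infinite_countable_subset by blast
  \<comment> \<open>\<open>prod_decode\<close> lists all pairs \<open>(i, j)\<close> in one
    sequence. The diagonal removes nothing, since \<open>f i (f i)^-1\<close> is the identity, which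
    every \<open>U n\<close> has to contain; off the diagonal injectivity of \<open>f\<close> keeps
    the identity in.\<close>
  define U where "U n = (case prod_decode n of (i, j) \<Rightarrow>
      if i = j then carrier G else carrier G - {f i \<otimes>\<^bsub>G\<^esub> inv\<^bsub>G\<^esub> f j})" for n
  have fc: "f i \<in> carrier G" for i
    using f(2) by auto
  have "openin T (U n)" for n
  proof -
    have "closedin T {x}" if "x \<in> carrier G" for x
      using that closedin_Hausdorff_singleton[OF Hausdorff] topspace_eq_carrier by metis
    then show ?thesis
      using openin_topspace[of T] fc
      by (auto simp: U_def closedin_def topspace_eq_carrier split: prod.split)
  qed
  moreover have "\<one>\<^bsub>G\<^esub> \<in> U n" for n
  proof -
    have "\<one>\<^bsub>G\<^esub> \<noteq> f i \<otimes>\<^bsub>G\<^esub> inv\<^bsub>G\<^esub> f j" if "i \<noteq> j" for i j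
      using that f(1) fc by (metis inj_eq inv_closed inv_equality inv_inv)
    then show ?thesis
      by (auto simp: U_def split: prod.split)
  qed
  ultimately obtain N V where N: "N \<lhd> G" "closedin T N" "N \<subseteq> (\<Inter>n. U n)"
    and V: "\<And>n::nat. openin T (V n)" "\<And>n. N \<subseteq> V n"
      "\<And>W. openin T W \<Longrightarrow> N \<subseteq> W \<Longrightarrow> \<exists>n. V n \<subseteq> W"
    using Kakutani_Kodaira[OF assms(3,4)] by metis
  interpret N: normal N G by fact
  let ?Q = "quotient_group_topology G T N" and ?q = "\<lambda>x. N #>\<^bsub>G\<^esub> x"
  interpret Q: topological_group "G Mod N" ?Q
    using N(1,2) by (rule topological_group_quotient)
  note open_q = open_map_rcoset[OF N(1)]
  have surj_q: "?q ` topspace T = topspace ?Q"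
    using quotient_map_rcoset by (rule quotient_imp_surjective_map)
  have cont_q: "continuous_map T ?Q ?q"
    using quotient_map_rcoset by (rule quotient_imp_continuous_map)
  \<comment> \<open>Equal cosets would put \<open>f i (f j)^-1\<close> into \<open>N\<close>, and so
    into the very \<open>U n\<close> from which it was removed.\<close>
  have "inj (\<lambda>i. ?q (f i))"
  proof (rule injI, rule ccontr)
    fix i j
    assume eq: "?q (f i) = ?q (f j)" and "i \<noteq> j"
    have "f i \<otimes>\<^bsub>G\<^esub> inv\<^bsub>G\<^esub> f j \<in> U (prod_encode (i, j))"
      using eq fc N(3) rcoset_eq_iff[OF N.subgroup_axioms] by blast
    then show False
      using \<open>i \<noteq> j\<close> by (simp add: U_def)
  qed
  moreover have "range (\<lambda>i. ?q (f i)) \<subseteq> carrier (G Mod N)"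
    using fc by (auto simp: FactGroup_def RCOSETS_def)
  ultimately have inf: "infinite (carrier (G Mod N))"
    using infinite_iff_countable_subset by blast
  have "second_countable ?Q"
  proof (rule Q.second_countable_if_Lindelof)
    show "Lindelof_space ?Q"
      using quotient_map_rcoset sigma_compact_imp_Lindelof_space[OF assms(3)]
      by (rule Lindelof_space_quotient_map_image)
    show "openin ?Q (?q ` V n)" for n
      using open_q V(1) unfolding open_map_def by blast
    have "?q \<one>\<^bsub>G\<^esub> = N"
      by (simp add: N.rcos_const is_group)
    moreover have "\<one>\<^bsub>G\<^esub> \<in> V n" for n
      using V(2) N.one_closed by blast
    ultimately show "\<one>\<^bsub>G Mod N\<^esub> \<in> ?q ` V n" for n
      by (metis imageI one_FactGroup)
    fix W
    assume W: "openin ?Q W" "\<one>\<^bsub>G Mod N\<^esub> \<in> W"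
    \<comment> \<open>The preimage of \<open>W\<close> is an open set containing all of
      \<open>N\<close>, so some \<open>V n\<close> fits inside it.\<close>
    have "openin T {x \<in> topspace T. ?q x \<in> W}"
      using cont_q W(1) by (rule openin_continuous_map_preimage)
    moreover have "N \<subseteq> {x \<in> topspace T. ?q x \<in> W}"
    proof
      fix x
      assume "x \<in> N"
      then have "x \<in> carrier G" "?q x = N"
        using N.subset N.rcos_const[OF is_group] by auto
      then show "x \<in> {x \<in> topspace T. ?q x \<in> W}"
        using W(2) by (simp add: topspace_eq_carrier)
    qed
    ultimately obtain n where "V n \<subseteq> {x \<in> topspace T. ?q x \<in> W}"
      using V(3) by metis
    then show "\<exists>n. ?q ` V n \<subseteq> W"
      by (intro exI[of _ n]) auto
  qed
  \<comment> \<open>Local compactness passes along the open continuous surjection \<open>?q\<close>,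
    and locally compact Hausdorff spaces are regular.\<close>
  moreover have "regular_space ?Q"
    using locally_compact_space_continuous_open_map_image[OF cont_q open_q surj_q assms(4)] Q.Hausdorff
    by (rule locally_compact_Hausdorff_imp_regular_space)
  ultimately have "separable_space ?Q" "metrizable_space ?Q"
    using second_countable_imp_separable_space
      second_countable_regular_Hausdorff_imp_metrizable_space[OF _ Q.Hausdorff] by blast+
  then show ?thesis
    using N(1,2) inf Q.topological_group_axioms by (intro exI[of _ N] conjI)
qed

end
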